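(* Let $S$ be a binary tree leaves (BTL) space with $|S|\ge 3$ and such that, for each leaf $s_i\in S$, all the distances $d(s_i,s_j)$, $j\ne i$, are distinct. Then for $k=2$ there are no invariant measures with full support; that is, for $j\in\{1,2\}$ there is no $\theta\in\mathcal P(S)$ with $\pi_{j,2}(\theta)=\theta$ and $\theta(\{s\})>0$ for every $s\in S$.
   Context: A binary tree leaves (BTL) space is a finite metric space $S=\{s_1,\dots,s_n\}$ obtained as follows: $S$ is the set of leaves of a finite binary tree, i.e. a finite tree in which every non-leaf vertex (branchpoint) has degree exactly 3, so that there are $|S|-2$ branchpoints; the edges have (positive) lengths, and the distance $d(s,s')$ between two leaves is the length of the unique path between them in the tree. $\mathcal P(S)$ is the set of Borel probability measures on a compact metric space $(S,d)$. Given $\theta\in\mathcal P(S)$ and integers $k\ge 2$, $1\le j\le k$, consider the Markov chain on $S$ which from state $s$ draws $k$ i.i.d. samples from $\theta$ and jumps to the $j$'th nearest of them to $s$ (ordering by increasing distance from $s$, ties broken uniformly at random). This chain has a unique stationary distribution, denoted $\pi_{j,k}(\theta)$, which defines a map $\pi_{j,k}:\mathcal P(S)\to\mathcal P(S)$. A distribution $\phi$ is invariant (for $\pi_{j,k}$) if $\pi_{j,k}(\phi)=\phi$. *)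

theory Defs
  imports "HOL-Probability.Probability" "HOL-Combinatorics.Multiset_Permutations"
    "Graph_Theory.Graph_Theory"
begin

section \<open>Binary trees with edge lengths\<close>

text \<open>
  A finite simple undirected graph is a symmetric loop-free digraph (\<^locale>\<open>pair_graph\<close>): every
  edge is represented by its two orientations, so the degree of a vertex is its out-degree and
  the edge length is a function on arcs that does not depend on the orientation.
  The library notion of a forest is not usable for such graphs, because going back and forth along
  an edge counts as a cycle of length 2 there; the cycles of the undirected graph are exactly the
  ones of length at least 3.
\<close>

locale binary_tree = pair_graph T
  for T :: "'v pair_pre_digraph" +
  fixes len :: "'v \<times> 'v \<Rightarrow> real"
  assumes connected_tree: "Digraph_Component.connected (with_proj T)"
    and acyclic_tree: "\<not> (\<exists>p. cycle p \<and> length p \<ge> 3)"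
    and degree_1_or_3: "v \<in> pverts T \<Longrightarrow> out_degree (with_proj T) v \<in> {1, 3}"
    and len_pos: "e \<in> parcs T \<Longrightarrow> 0 < len e"
    and len_sym: "(u, v) \<in> parcs T \<Longrightarrow> len (v, u) = len (u, v)"
begin

definition leaves :: "'v set" where
  "leaves = {v \<in> pverts T. out_degree (with_proj T) v = 1}"

text \<open>\<^term>\<open>apath u p v\<close> says that \<^term>\<open>p\<close> is a walk without repeated vertices; in a tree there is
  exactly one between any two vertices.\<close>

definition tree_dist :: "'v \<Rightarrow> 'v \<Rightarrow> real" where
  "tree_dist u v = awalk_cost len (THE p. apath u p v)"

end

definition btl_space ::
    "'v pair_pre_digraph \<Rightarrow> ('v \<times> 'v \<Rightarrow> real) \<Rightarrow> 'v set \<Rightarrow> ('v \<Rightarrow> 'v \<Rightarrow> real) \<Rightarrow> bool" where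
  "btl_space T len S d \<longleftrightarrow>
     binary_tree T len \<and> S = binary_tree.leaves T \<and>
     (\<forall>s\<in>S. \<forall>t\<in>S. d s t = binary_tree.tree_dist T len s t)"


section \<open>The chain jumping to the \<open>j\<close>-th nearest of \<open>k\<close> samples\<close>

text \<open>Every subset of a finite metric space is Borel, so the Borel probability measures on \<open>S\<close> are the
  probability mass functions supported in \<open>S\<close>.\<close>

definition prob_measures_on :: "'a set \<Rightarrow> 'a pmf set" where
  "prob_measures_on S = {\<theta>. set_pmf \<theta> \<subseteq> S}"

text \<open>Ties are broken uniformly at random: given the samples \<open>xs\<close>, a uniformly random element is drawn
  among all orderings \<open>is\<close> of the sample indices along which the distance to \<open>s\<close> is nondecreasing.
  Ranks \<open>j\<close> are counted from 1, list positions from 0.\<close>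

definition jump :: "('a \<Rightarrow> 'a \<Rightarrow> real) \<Rightarrow> nat \<Rightarrow> nat \<Rightarrow> 'a pmf \<Rightarrow> 'a \<Rightarrow> 'a pmf" where
  "jump d j k \<theta> s = do {
     xs \<leftarrow> replicate_pmf k \<theta>;
     is \<leftarrow> pmf_of_set {is \<in> permutations_of_set {..<k}. sorted (map (\<lambda>i. d s (xs ! i)) is)};
     return_pmf (xs ! (is ! (j - 1)))
   }"

definition stationary :: "'a set \<Rightarrow> ('a \<Rightarrow> 'a pmf) \<Rightarrow> 'a pmf \<Rightarrow> bool" where
  "stationary S K \<phi> \<longleftrightarrow> \<phi> \<in> prob_measures_on S \<and> bind_pmf \<phi> K = \<phi>"

definition \<pi>_map :: "'a set \<Rightarrow> ('a \<Rightarrow> 'a \<Rightarrow> real) \<Rightarrow> nat \<Rightarrow> nat \<Rightarrow> 'a pmf \<Rightarrow> 'a pmf" where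
  "\<pi>_map S d j k \<theta> = (THE \<phi>. stationary S (jump d j k \<theta>) \<phi>)"

definition invariant_dist :: "'a set \<Rightarrow> ('a \<Rightarrow> 'a \<Rightarrow> real) \<Rightarrow> nat \<Rightarrow> nat \<Rightarrow> 'a pmf \<Rightarrow> bool" where
  "invariant_dist S d j k \<theta> \<longleftrightarrow> \<theta> \<in> prob_measures_on S \<and> \<pi>_map S d j k \<theta> = \<theta>"

end

theory Submission
  imports Defs
begin

text \<open>
  The proof plays the two ends of a longest path against each other.

  With two samples, the chain jumps to \<open>t\<close> only if \<open>t\<close> is drawn, so \<open>\<theta> t\<close> cancels from the stationarity
  equation at \<open>t\<close>. When distances from each leaf are distinct, what remains says, for \<open>j = 1\<close> as well
  as for \<open>j = 2\<close>, that for independent \<open>X\<close>, \<open>U\<close> with law \<open>\<theta>\<close> the point \<open>U\<close> is as likely to be nearer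
  to \<open>X\<close> than \<open>t\<close> is as to be farther from it (\<open>invariant_full_support_balance\<close>). This step needs
  that \<open>\<theta>\<close> is a stationary distribution of its own chain. Since \<open>\<pi>_map\<close> is a definite description,
  that rests on existence and uniqueness of the stationary distribution
  (\<open>doeblin_unique_stationary\<close>).

  Let \<open>x\<close> and \<open>y\<close> be two leaves at maximal distance. In a tree, one of them is a farthest leaf from any
  given leaf \<open>s\<close> (\<open>diameter_end_farthest\<close>), because the paths between three vertices of a tree share
  a common vertex (\<open>median_exists\<close>). For a value \<open>s\<close> of \<open>X\<close> whose farthest leaf is \<open>x\<close>, every
  \<open>U\<close> other than \<open>x\<close> is nearer than \<open>x\<close>, which is the most extreme imbalance possible in one
  direction; at worst it is compensated by the opposite extreme for \<open>y\<close>. But the opposite extreme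
  is attained only at \<open>s = y\<close>, since any other \<open>s\<close> has at least itself nearer than \<open>y\<close>. So a third
  leaf makes the sum of the two normalised imbalances strictly positive, and they cannot both vanish
  (\<open>no_invariant_if_two_farthest_points\<close>).
\<close>

section \<open>Paths in a binary tree\<close>

context binary_tree begin

lemma exists_apath:
  assumes "u \<in> pverts T" "v \<in> pverts T"
  shows "\<exists>p. apath u p v"
proof -
  have "strongly_connected (with_proj T)"
    using connected_tree sym_arcs symmetric_connected_imp_strongly_connected by blast
  then show ?thesis
    using assms by (auto simp: strongly_connected_def reachable_apath)
qed

lemma apath_within_awalk:
  assumes "awalk u p v"
  shows "\<exists>q. apath u q v \<and> set (pawalk_verts u q) \<subseteq> set (pawalk_verts u p)"
proof -
  have *: "apath u (awalk_to_apath p) v" "set (awalk_to_apath p) \<subseteq> set p"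
    using assms apath_awalk_to_apath awalk_to_apath_subset by blast+
  then have "set (pawalk_verts u (awalk_to_apath p)) \<subseteq> set (pawalk_verts u p)"
    using set_awalk_verts[OF assms] set_awalk_verts[of u "awalk_to_apath p" v]
    by (auto dest: awalkI_apath)
  with * show ?thesis by blast
qed

text \<open>
  Two paths that leave \<open>u\<close> along different edges end at the same vertex, so the first continued by
  the reverse of the second connects the two neighbours of \<open>u\<close> without visiting \<open>u\<close>; shortened to
  a path and closed up through \<open>u\<close>, it is a cycle. It has length at least 3 because the two
  neighbours differ, so it is not one of the trivial cycles that run along an edge and back.
\<close>

lemma apath_unique:
  assumes "apath u p v" "apath u q v"
  shows "p = q"
  using assms
proof (induction p arbitrary: u q)
  case Nil
  then show ?case using apath_ends by blast
next
  case (Cons e p)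
  have "q \<noteq> []"
    using Cons.prems apath_ends by blast
  then obtain e' q' where q: "q = e' # q'" by (cases q) auto
  from Cons.prems(1) have e: "e \<in> parcs T" "fst e = u" "apath (snd e) p v"
    "u \<notin> set (pawalk_verts (snd e) p)"
    by (auto simp: apath_Cons_iff)
  from Cons.prems(2) have e': "e' \<in> parcs T" "fst e' = u" "apath (snd e') q' v"
    "u \<notin> set (pawalk_verts (snd e') q')"
    by (auto simp: apath_Cons_iff q)
  show ?case
  proof (cases "snd e = snd e'")
    case True
    then have "e = e'" using e e' by (simp add: prod_eq_iff)
    moreover have "p = q'" using Cons.IH e e' True by auto
    ultimately show ?thesis by (simp add: q)
  next
    case False
    have w: "awalk (snd e) p v" "awalk v (rev_path q') (snd e')"
      using e(3) e'(3) by (auto intro: awalkI_apath)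
    have "u \<notin> set (pawalk_verts v (rev_path q'))"
      using awalk_verts_rev_path[OF awalkI_apath[OF e'(3)]] e'(4) by simp
    then have "u \<notin> set (pawalk_verts (snd e) (p @ rev_path q'))"
      using e(4) set_awalk_verts_append[OF w] by auto
    moreover obtain r where r: "apath (snd e) r (snd e')"
      "set (pawalk_verts (snd e) r) \<subseteq> set (pawalk_verts (snd e) (p @ rev_path q'))"
      using apath_within_awalk[OF awalk_appendI[OF w]] by blast
    ultimately have u: "u \<notin> set (pawalk_verts (snd e) r)" by blast
    have arc_home: "(snd e', u) \<in> parcs T"
      using arcs_symmetric[of u "snd e'"] e'(1,2) by (cases e') auto
    have rn: "r \<noteq> []" using r(1) False by (auto simp: apath_Nil_iff)
    let ?c = "e # r @ [(snd e', u)]"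
    have "awalk (snd e') [(snd e', u)] u"
      using arc_home by (auto simp: awalk_simps dest: in_arcsD2)
    with r(1) have tail: "awalk (snd e) (r @ [(snd e', u)]) u"
      using awalk_appendI awalkI_apath by blast
    then have "awalk u ?c u"
      using e(1,2) by (auto simp: awalk_Cons_iff)
    moreover have "pawalk_verts (snd e) (r @ [(snd e', u)]) = pawalk_verts (snd e) r @ [u]"
      using awalk_verts_append[OF tail] by simp
    then have "distinct (tl (pawalk_verts u ?c))"
      using u r(1) by (simp add: apath_def)
    ultimately have "cycle ?c" by (auto simp: cycle_def)
    moreover have "length ?c \<ge> 3" using rn by (cases r) auto
    ultimately show ?thesis using acyclic_tree by blast
  qed
qed

lemma tree_dist_apath:
  assumes "apath u p v"
  shows "tree_dist u v = awalk_cost len p"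
proof -
  have "(THE p. apath u p v) = p" using assms apath_unique by blast
  then show ?thesis by (simp add: tree_dist_def)
qed

lemma awalk_cost_nonneg: "set p \<subseteq> parcs T \<Longrightarrow> 0 \<le> awalk_cost len p"
  by (induction p) (auto simp: less_imp_le len_pos add_nonneg_nonneg)

text \<open>
  Removing closed detours turns any walk into the path between its ends, and detours have
  nonnegative cost.
\<close>

lemma tree_dist_le_awalk_cost:
  assumes "awalk u p v"
  shows "tree_dist u v \<le> awalk_cost len p"
  using assms
proof (induct rule: awalk_to_apath_induct)
  case (path p)
  then show ?case by (simp add: tree_dist_apath apath_def)
next
  case (decomp p q r s)
  then have "p = q @ r @ s" by (auto elim: awalk_cyc_decompE)
  moreover from this have "0 \<le> awalk_cost len r"
    using decomp(1) by (intro awalk_cost_nonneg) auto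
  ultimately show ?case using decomp by simp
qed

lemma tree_dist_triangle:
  assumes "u \<in> pverts T" "v \<in> pverts T" "w \<in> pverts T"
  shows "tree_dist u w \<le> tree_dist u v + tree_dist v w"
proof -
  obtain p q where pq: "apath u p v" "apath v q w"
    using exists_apath assms by blast
  then have "awalk u (p @ q) w" by (blast intro: awalk_appendI awalkI_apath)
  from tree_dist_le_awalk_cost[OF this] show ?thesis
    using pq by (simp add: tree_dist_apath)
qed

lemma tree_dist_commute:
  assumes "u \<in> pverts T" "v \<in> pverts T"
  shows "tree_dist u v = tree_dist v u"
proof -
  obtain p where p: "apath u p v" using exists_apath assms by blast
  have "set p \<subseteq> parcs T \<Longrightarrow> awalk_cost len (rev_path p) = awalk_cost len p" for p
    by (induction p) (auto simp: len_sym)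
  moreover have "set p \<subseteq> parcs T" using p by (auto dest: awalkI_apath)
  moreover have "apath v (rev_path p) u" using p by simp
  ultimately show ?thesis using p tree_dist_apath by metis
qed

lemma tree_dist_self: "u \<in> pverts T \<Longrightarrow> tree_dist u u = 0"
  using tree_dist_apath[of u "[]" u] by (simp add: apath_Nil_iff)

lemma tree_dist_pos:
  assumes "u \<in> pverts T" "v \<in> pverts T" "u \<noteq> v"
  shows "0 < tree_dist u v"
proof -
  obtain p where p: "apath u p v" using exists_apath assms by blast
  then obtain e q where eq: "p = e # q"
    using assms(3) by (cases p) (auto simp: apath_Nil_iff)
  have "set p \<subseteq> parcs T" using p by (auto dest: awalkI_apath)
  then have "0 < len e" "0 \<le> awalk_cost len q"
    using eq by (auto intro: len_pos awalk_cost_nonneg)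
  then show ?thesis using p eq by (simp add: tree_dist_apath)
qed

text \<open>
  Betweenness is expressed by the vertices of paths, which can be cut and joined; \<open>on_path_dist\<close>
  translates it into additivity of the distance.
\<close>

definition on_path :: "'v \<Rightarrow> 'v \<Rightarrow> 'v \<Rightarrow> bool" where
  "on_path u m v \<longleftrightarrow> (\<exists>p. apath u p v \<and> m \<in> set (pawalk_verts u p))"

lemma on_path_in_pverts: "on_path u m v \<Longrightarrow> m \<in> pverts T"
  by (auto simp: on_path_def dest!: awalkI_apath)

lemma on_path_dist:
  assumes "on_path u m v"
  shows "tree_dist u v = tree_dist u m + tree_dist m v"
proof -
  obtain p where p: "apath u p v" "m \<in> set (pawalk_verts u p)"
    using assms on_path_def by blast
  then obtain q r where qr: "p = q @ r" "awalk u q m" "awalk m r v"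
    using awalk_decomp[OF awalkI_apath] by metis
  then have "apath u q m" "apath m r v"
    using p(1) by (auto simp: apath_append_iff)
  then show ?thesis
    using p(1) qr(1) by (simp add: tree_dist_apath)
qed

text \<open>
  The walk from \<open>x\<close> to \<open>y\<close> that passes through \<open>z\<close> contains a path, which by uniqueness is the path
  from \<open>x\<close> to \<open>y\<close>.
\<close>

lemma on_path_cases:
  assumes "on_path x m y" "z \<in> pverts T"
  shows "on_path x m z \<or> on_path z m y"
proof -
  obtain p where p: "apath x p y" "m \<in> set (pawalk_verts x p)"
    using assms on_path_def by blast
  then have "x \<in> pverts T" "y \<in> pverts T" by (auto dest: awalkI_apath)
  then obtain q r where qr: "apath x q z" "apath z r y"
    using exists_apath assms(2) by blast
  then have w: "awalk x q z" "awalk z r y" by (auto intro: awalkI_apath)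
  from apath_within_awalk[OF awalk_appendI[OF this]] p apath_unique
  have "m \<in> set (pawalk_verts x (q @ r))" by blast
  then show ?thesis
    using qr set_awalk_verts_append[OF w] by (auto simp: on_path_def)
qed

text \<open>
  The median is the first vertex \<open>m\<close> at which the path from \<open>s\<close> to \<open>x\<close> meets the path from \<open>x\<close> to \<open>y\<close>:
  up to \<open>m\<close> the former avoids the latter, so following the latter from \<open>m\<close> to \<open>y\<close> gives a path from
  \<open>s\<close> to \<open>y\<close>.
\<close>

lemma median_exists:
  assumes "s \<in> pverts T" "x \<in> pverts T" "y \<in> pverts T"
  shows "\<exists>m. on_path s m x \<and> on_path s m y \<and> on_path x m y"
proof -
  obtain p q where p: "apath s p x" and q: "apath x q y"
    using exists_apath assms by blast
  have wp: "awalk s p x" and wq: "awalk x q y" using p q by (auto intro: awalkI_apath)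
  have "last (pawalk_verts s p) = x" using wp by (elim awalkE')
  moreover have "pawalk_verts s p \<noteq> []" by (cases p) auto
  ultimately have "x \<in> set (pawalk_verts s p)" using last_in_set by metis
  moreover have "x \<in> set (pawalk_verts x q)" using hd_in_awalk_verts(2)[OF q] .
  ultimately have "\<exists>v\<in>set (pawalk_verts s p). v \<in> set (pawalk_verts x q)" by blast
  then obtain ys m zs where m: "pawalk_verts s p = ys @ m # zs" "m \<in> set (pawalk_verts x q)"
    "\<forall>v\<in>set ys. v \<notin> set (pawalk_verts x q)"
    by (elim split_list_first_propE)
  have "pcas s p x" using wp by (simp add: awalk_def)
  then obtain p1 p2 where p12: "pcas s p1 m" "pcas m p2 x" "p = p1 @ p2"
    "pawalk_verts s p1 = ys @ [m]" "pawalk_verts m p2 = m # zs"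
    by (rule awalk_decomp_verts[OF _ m(1)])
  obtain q1 q2 where q12: "q = q1 @ q2" "awalk x q1 m" "awalk m q2 y"
    using awalk_decomp[OF wq m(2)] by metis
  have p1: "apath s p1 m" and q2: "apath m q2 y"
    using p q p12 q12 by (auto simp: apath_append_iff)
  have "set (pawalk_verts m q2) \<subseteq> set (pawalk_verts x q)"
    using set_awalk_verts_append[OF q12(2,3)] q12(1) by auto
  then have "set (tl (pawalk_verts m q2)) \<subseteq> set (pawalk_verts x q)"
    by (cases q2) auto
  moreover have "m \<notin> set (tl (pawalk_verts m q2))"
    using q2 by (cases q2) (auto simp: apath_Cons_iff)
  ultimately have "set (pawalk_verts s p1) \<inter> set (tl (pawalk_verts m q2)) = {}"
    using p12(4) m(3) by auto
  then have "apath s (p1 @ q2) y"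
    using p1 q2 p12(4) by (simp add: apath_append_iff)
  moreover have "m \<in> set (pawalk_verts s (p1 @ q2))"
    using set_awalk_verts_append[OF awalkI_apath awalkI_apath, OF p1 q2] p12(4) by simp
  ultimately show ?thesis
    using p q m unfolding on_path_def by force
qed

text \<open>
  Let \<open>m\<close> be the median of \<open>s\<close> and the two ends \<open>x\<close>, \<open>y\<close> of a diameter. For any \<open>u\<close>, the vertex \<open>m\<close> is
  on the path from \<open>u\<close> to one of the ends, say \<open>x\<close>. As \<open>u\<close> is not farther from \<open>x\<close> than \<open>y\<close> is, it is
  not farther from \<open>m\<close> than \<open>y\<close> is. The route from \<open>s\<close> to \<open>u\<close> through \<open>m\<close> is then at most as long
  as the path from \<open>s\<close> to \<open>y\<close>, which does pass through \<open>m\<close>.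
\<close>

lemma diameter_end_farthest:
  assumes "L \<subseteq> pverts T" "x \<in> L" "y \<in> L"
    and diam: "\<And>u v. u \<in> L \<Longrightarrow> v \<in> L \<Longrightarrow> tree_dist u v \<le> tree_dist x y"
    and "s \<in> pverts T" "u \<in> L"
  shows "tree_dist s u \<le> max (tree_dist s x) (tree_dist s y)"
proof -
  have V: "x \<in> pverts T" "y \<in> pverts T" "u \<in> pverts T" using assms by auto
  obtain m where m: "on_path s m x" "on_path s m y" "on_path x m y"
    using median_exists assms(5) V by blast
  have su: "tree_dist s u \<le> tree_dist s m + tree_dist m u"
    using tree_dist_triangle on_path_in_pverts m(1) assms(5) V by blast
  from on_path_cases[OF m(3) V(3)] show ?thesis
  proof
    assume "on_path x m u"
    then have "tree_dist m u \<le> tree_dist m y"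
      using diam[of x u] assms m(3) by (simp add: on_path_dist)
    then show ?thesis using su m(2) on_path_dist by fastforce
  next
    assume "on_path u m y"
    then have "tree_dist u m \<le> tree_dist x m"
      using diam[of u y] assms m(3) by (simp add: on_path_dist)
    then have "tree_dist m u \<le> tree_dist m x"
      using tree_dist_commute on_path_in_pverts m(1) V by metis
    then show ?thesis using su m(1) on_path_dist by fastforce
  qed
qed
end

section \<open>Stationary distributions of finite chains\<close>

lemma pmf_bind_finite_support:
  assumes "finite S" "set_pmf p \<subseteq> S"
  shows "pmf (bind_pmf p f) t = (\<Sum>s\<in>S. pmf p s * pmf (f s) t)"
  unfolding pmf_bind using assms by (subst integral_measure_pmf[of S]) auto

text \<open>
  All rows of the kernel contain the common part of mass \<open>\<epsilon>\<close> at \<open>t0\<close>. It annihilates a vector of total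
  mass 0, and the nonnegative remainder has rows of mass \<open>1 - \<epsilon>\<close>. Applied to the difference of two
  distributions, this is the total variation contraction of Doeblin.
\<close>

lemma minorized_kernel_contracts:
  fixes x :: "'a \<Rightarrow> real"
  assumes S: "finite S" "\<And>s. s \<in> S \<Longrightarrow> set_pmf (K s) \<subseteq> S"
    and minor: "t0 \<in> S" "\<And>s. s \<in> S \<Longrightarrow> \<epsilon> \<le> pmf (K s) t0"
    and zero: "(\<Sum>s\<in>S. x s) = 0"
  shows "(\<Sum>t\<in>S. \<bar>\<Sum>s\<in>S. x s * pmf (K s) t\<bar>) \<le> (1 - \<epsilon>) * (\<Sum>s\<in>S. \<bar>x s\<bar>)"
proof -
  define r where "r s t = pmf (K s) t - (if t = t0 then \<epsilon> else 0)" for s t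
  have r0: "0 \<le> r s t" if "s \<in> S" for s t
    using minor that by (auto simp: r_def)
  have r1: "(\<Sum>t\<in>S. r s t) = 1 - \<epsilon>" if "s \<in> S" for s
    using S minor that by (simp add: r_def sum_subtractf sum_pmf_eq_1)
  have "(\<Sum>t\<in>S. \<bar>\<Sum>s\<in>S. x s * pmf (K s) t\<bar>) = (\<Sum>t\<in>S. \<bar>\<Sum>s\<in>S. x s * r s t\<bar>)"
    using zero by (simp add: r_def right_diff_distrib sum_subtractf flip: sum_distrib_right)
  also have "\<dots> \<le> (\<Sum>t\<in>S. \<Sum>s\<in>S. \<bar>x s\<bar> * r s t)"
    by (intro sum_mono order_trans[OF sum_abs]) (auto simp: abs_mult r0)
  also have "\<dots> = (\<Sum>s\<in>S. \<bar>x s\<bar> * (\<Sum>t\<in>S. r s t))"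
    by (subst sum.swap) (simp add: sum_distrib_left)
  also have "\<dots> = (1 - \<epsilon>) * (\<Sum>s\<in>S. \<bar>x s\<bar>)"
    by (simp add: r1 sum_distrib_left mult.commute)
  finally show ?thesis .
qed

text \<open>
  The contraction makes the iterates of the chain started at \<open>t0\<close> converge pointwise, with
  geometrically decreasing steps, to a stationary distribution; it also rules out a second one.
\<close>

lemma doeblin_unique_stationary:
  assumes S: "finite S" "\<And>s. s \<in> S \<Longrightarrow> set_pmf (K s) \<subseteq> S"
    and minor: "t0 \<in> S" "\<And>s. s \<in> S \<Longrightarrow> \<epsilon> \<le> pmf (K s) t0" and pos: "0 < \<epsilon>"
  shows "\<exists>!\<phi>. stationary S K \<phi>"
proof (rule ex_ex1I)
  define P where "P = (\<lambda>\<phi>. bind_pmf \<phi> K)"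
  have P_supp: "set_pmf (P \<phi>) \<subseteq> S" if "set_pmf \<phi> \<subseteq> S" for \<phi>
    using S that by (auto simp: P_def)
  have contract: "(\<Sum>t\<in>S. \<bar>pmf (P \<phi>) t - pmf (P \<psi>) t\<bar>) \<le> (1 - \<epsilon>) * (\<Sum>t\<in>S. \<bar>pmf \<phi> t - pmf \<psi> t\<bar>)"
    if "set_pmf \<phi> \<subseteq> S" "set_pmf \<psi> \<subseteq> S" for \<phi> \<psi>
    using minorized_kernel_contracts[of S K t0 \<epsilon> "\<lambda>s. pmf \<phi> s - pmf \<psi> s"] that S minor
    by (simp add: P_def pmf_bind_finite_support[OF S(1)] sum_pmf_eq_1 sum_subtractf left_diff_distrib)
  have "\<epsilon> \<le> 1" using minor pmf_le_1[of "K t0" t0] by force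

  show "\<exists>\<phi>. stationary S K \<phi>"
  proof -
    define \<phi> where "\<phi> n = (P ^^ n) (return_pmf t0)" for n
    have supp: "set_pmf (\<phi> n) \<subseteq> S" for n
      by (induction n) (use minor P_supp in \<open>auto simp: \<phi>_def\<close>)
    define D where "D n = (\<Sum>t\<in>S. \<bar>pmf (\<phi> (Suc n)) t - pmf (\<phi> n) t\<bar>)" for n
    have D: "D n \<le> (1 - \<epsilon>) ^ n * D 0" for n
    proof (induction n)
      case (Suc n)
      have "D (Suc n) \<le> (1 - \<epsilon>) * D n"
        using contract[OF supp supp, of "Suc n" n] by (simp add: D_def \<phi>_def)
      also have "\<dots> \<le> (1 - \<epsilon>) * ((1 - \<epsilon>) ^ n * D 0)"
        using Suc \<open>\<epsilon> \<le> 1\<close> by (intro mult_left_mono) auto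
      finally show ?case by simp
    qed simp
    have "convergent (\<lambda>n. pmf (\<phi> n) t)" if "t \<in> S" for t
    proof -
      have "\<bar>pmf (\<phi> (Suc n)) t - pmf (\<phi> n) t\<bar> \<le> (1 - \<epsilon>) ^ n * D 0" for n
        using D[of n] member_le_sum[OF that _ S(1), of "\<lambda>t. \<bar>pmf (\<phi> (Suc n)) t - pmf (\<phi> n) t\<bar>"]
        by (simp add: D_def)
      moreover have "summable (\<lambda>n. (1 - \<epsilon>) ^ n * D 0)"
        using pos \<open>\<epsilon> \<le> 1\<close> by (intro summable_mult2 summable_geometric) auto
      ultimately have "summable (\<lambda>n. pmf (\<phi> (Suc n)) t - pmf (\<phi> n) t)"
        using summable_comparison_test'[of "\<lambda>n. (1 - \<epsilon>) ^ n * D 0" 0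
            "\<lambda>n. pmf (\<phi> (Suc n)) t - pmf (\<phi> n) t"] by simp
      then obtain L where "(\<lambda>n. pmf (\<phi> n) t - pmf (\<phi> 0) t) \<longlonglongrightarrow> L"
        using summable_LIMSEQ sum_lessThan_telescope[of "\<lambda>n. pmf (\<phi> n) t"] by fastforce
      from tendsto_add[OF this tendsto_const[of "pmf (\<phi> 0) t"]] show ?thesis
        by (auto intro: convergentI)
    qed
    then obtain l where l: "\<And>t. t \<in> S \<Longrightarrow> (\<lambda>n. pmf (\<phi> n) t) \<longlonglongrightarrow> l t"
      unfolding convergent_def by metis
    have l_nonneg: "0 \<le> l t" if "t \<in> S" for t
      using LIMSEQ_le_const[OF l[OF that]] by auto
    have "(\<lambda>n. \<Sum>t\<in>S. pmf (\<phi> n) t) \<longlonglongrightarrow> (\<Sum>t\<in>S. l t)"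
      by (intro tendsto_sum l)
    then have l_sum: "(\<Sum>t\<in>S. l t) = 1"
      using sum_pmf_eq_1[OF S(1) supp] by (simp add: LIMSEQ_const_iff)
    \<comment> \<open>All iterates vanish off \<open>S\<close>, so the limit distribution must as well.\<close>
    define g where "g t = (if t \<in> S then l t else 0)" for t
    have g_nonneg: "0 \<le> g t" for t
      using l_nonneg by (simp add: g_def)
    have "(\<integral>\<^sup>+t. ennreal (g t) \<partial>count_space UNIV) = (\<Sum>t\<in>S. ennreal (g t))"
      using S(1) by (intro nn_integral_count_space'[of S]) (auto simp: g_def)
    also have "\<dots> = ennreal (\<Sum>t\<in>S. g t)"
      using g_nonneg by (intro sum_ennreal)
    also have "(\<Sum>t\<in>S. g t) = 1"
      using l_sum by (simp add: g_def)
    finally have "(\<integral>\<^sup>+t. ennreal (g t) \<partial>count_space UNIV) = 1" by simp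
    then have g_pmf: "pmf (embed_pmf g) t = g t" for t
      using g_nonneg by (intro pmf_embed_pmf) auto
    have g_supp: "set_pmf (embed_pmf g) \<subseteq> S"
      by (auto simp: set_pmf_iff g_pmf g_def split: if_splits)
    have "pmf (P (embed_pmf g)) t = pmf (embed_pmf g) t" for t
    proof (cases "t \<in> S")
      case True
      have "(\<lambda>n. pmf (\<phi> (Suc n)) t) \<longlonglongrightarrow> (\<Sum>s\<in>S. l s * pmf (K s) t)"
        unfolding \<phi>_def funpow.simps o_def P_def[symmetric]
        unfolding P_def pmf_bind_finite_support[OF S(1) supp[unfolded \<phi>_def P_def]]
        using l by (intro tendsto_intros) (simp add: \<phi>_def P_def)
      moreover have "(\<lambda>n. pmf (\<phi> (Suc n)) t) \<longlonglongrightarrow> l t"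
        using l[OF True] by (rule LIMSEQ_Suc)
      ultimately have "(\<Sum>s\<in>S. l s * pmf (K s) t) = l t"
        by (rule LIMSEQ_unique)
      then show ?thesis
        using True by (simp add: P_def pmf_bind_finite_support[OF S(1) g_supp] g_pmf g_def)
    next
      case False
      then show ?thesis
        using g_supp P_supp[OF g_supp] by (metis set_pmf_iff subset_iff)
    qed
    then have "P (embed_pmf g) = embed_pmf g" by (rule pmf_eqI)
    then show ?thesis
      using g_supp by (auto simp: stationary_def prob_measures_on_def P_def)
  qed

  fix \<phi> \<psi> assume "stationary S K \<phi>" "stationary S K \<psi>"
  then have *: "set_pmf \<phi> \<subseteq> S" "set_pmf \<psi> \<subseteq> S" "P \<phi> = \<phi>" "P \<psi> = \<psi>"
    by (auto simp: stationary_def prob_measures_on_def P_def)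
  let ?\<delta> = "\<Sum>t\<in>S. \<bar>pmf \<phi> t - pmf \<psi> t\<bar>"
  have "\<epsilon> * ?\<delta> \<le> 0"
    using contract[OF *(1,2)] *(3,4) by (simp add: algebra_simps)
  then have "?\<delta> \<le> 0" using pos by (simp add: mult_le_0_iff)
  then have "?\<delta> = 0" by (intro order_antisym sum_nonneg) auto
  then have "pmf \<phi> t = pmf \<psi> t" if "t \<in> S" for t
    using that S(1) by (simp add: sum_nonneg_eq_0_iff)
  then show "\<phi> = \<psi>"
    using * by (intro pmf_eqI) (metis set_pmf_iff subset_iff)
qed

section \<open>The chain with two samples\<close>

text \<open>
  If only equal samples tie, then the random tie-breaking does not change the selected point, and the
  \<open>j\<close>-th nearest of two samples becomes a deterministic function of them.
\<close>

lemma ranked_sample_of_two: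
  assumes tie: "d s x = d s y \<Longrightarrow> x = y" and j: "j \<in> {1, 2}"
  shows "bind_pmf (pmf_of_set {is \<in> permutations_of_set {..<2}. sorted (map (\<lambda>i. d s ([x, y] ! i)) is)})
           (\<lambda>is. return_pmf ([x, y] ! (is ! (j - 1)))) =
         return_pmf (if (d s x \<le> d s y) = (j = 1) then x else y)"
    (is "bind_pmf (pmf_of_set ?A) ?f = _")
proof -
  have "{..<2::nat} = {0, 1}" by auto
  then have perms: "permutations_of_set {..<2::nat} = {[0, 1], [1, 0]}"
    by (simp add: permutations_of_set_doubleton)
  consider "d s x < d s y" | "d s y < d s x" | "x = y" using tie by force
  then show ?thesis
  proof cases
    case 1
    then have A: "?A = {[0, 1]}" unfolding perms by auto
    show ?thesis unfolding A using 1 j by (auto simp: pmf_of_set_singleton bind_return_pmf)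
  next
    case 2
    then have A: "?A = {[1, 0]}" unfolding perms by auto
    show ?thesis unfolding A using 2 j by (auto simp: pmf_of_set_singleton bind_return_pmf)
  next
    case 3
    then have A: "?A = {[0, 1], [1, 0]}" unfolding perms by auto
    have const: "?f is = return_pmf x" if "is \<in> set_pmf (pmf_of_set {[0, 1], [1, 0]})" for "is"
      using that 3 j by auto
    have "bind_pmf (pmf_of_set {[0, 1], [1, 0]}) ?f =
        bind_pmf (pmf_of_set {[0, 1], [1, 0]}) (\<lambda>_ :: nat list. return_pmf x)"
      by (rule bind_pmf_cong[OF refl]) (rule const)
    then show ?thesis unfolding A using 3 by (simp only: bind_pmf_const if_cancel)
  qed
qed

lemma jump_two:
  assumes "set_pmf \<theta> \<subseteq> S" "inj_on (d s) S" "j \<in> {1, 2}"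
  shows "jump d j 2 \<theta> s = bind_pmf \<theta> (\<lambda>x. bind_pmf \<theta> (\<lambda>y.
           return_pmf (if (d s x \<le> d s y) = (j = 1) then x else y)))"
proof -
  have "jump d j 2 \<theta> s = bind_pmf \<theta> (\<lambda>x. bind_pmf \<theta> (\<lambda>y.
      bind_pmf (pmf_of_set {is \<in> permutations_of_set {..<2}. sorted (map (\<lambda>i. d s ([x, y] ! i)) is)})
           (\<lambda>is. return_pmf ([x, y] ! (is ! (j - 1))))))"
    unfolding jump_def by (simp add: numeral_2_eq_2 bind_assoc_pmf bind_return_pmf)
  also have "\<dots> = bind_pmf \<theta> (\<lambda>x. bind_pmf \<theta> (\<lambda>y.
           return_pmf (if (d s x \<le> d s y) = (j = 1) then x else y)))"
    using assms by (intro bind_pmf_cong refl ranked_sample_of_two) (auto dest: inj_onD)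
  finally show ?thesis .
qed

text \<open>
  This is twice the probability that a sample from \<open>\<theta>\<close> is nearer to \<open>s\<close> than \<open>t\<close> is, ties being counted
  with weight one half. With this convention exchanging nearer and farther is the reflection
  \<open>c \<mapsto> 2 - c\<close>, which is why the cases \<open>j = 1\<close> and \<open>j = 2\<close> lead to the same equation.
\<close>

definition closer_mass :: "'a set \<Rightarrow> ('a \<Rightarrow> 'a \<Rightarrow> real) \<Rightarrow> 'a pmf \<Rightarrow> 'a \<Rightarrow> 'a \<Rightarrow> real" where
  "closer_mass S d \<theta> s t =
     (\<Sum>u\<in>S. pmf \<theta> u * (of_bool (d s u < d s t) + of_bool (d s u \<le> d s t)))"

text \<open>
  The chain jumps to \<open>t\<close> if one of the two samples is \<open>t\<close> and is selected against the other one.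
  Asymmetric tie-breaking between the first and the second sample produces one strict and one
  non-strict comparison.
\<close>

lemma pmf_jump_two:
  assumes "finite S" "set_pmf \<theta> \<subseteq> S" "inj_on (d s) S" "j \<in> {1, 2}" "t \<in> S"
  shows "pmf (jump d j 2 \<theta> s) t =
    pmf \<theta> t * (if j = 1 then 2 - closer_mass S d \<theta> s t else closer_mass S d \<theta> s t)"
proof -
  let ?sel = "\<lambda>x y. (d s x \<le> d s y) = (j = 1)"
  have ret: "pmf (return_pmf a) t = of_bool (a = t)" for a
    by (simp add: pmf_return)
  have delta: "(\<Sum>x\<in>S. of_bool (x = t) * f x) = f t" for f :: "'a \<Rightarrow> real"
  proof -
    have "(\<Sum>x\<in>S. of_bool (x = t) * f x) = (\<Sum>x\<in>S. if x = t then f x else 0)"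
      by (intro sum.cong) auto
    then show ?thesis using assms(1,5) by simp
  qed
  have "pmf (jump d j 2 \<theta> s) t =
    (\<Sum>x\<in>S. pmf \<theta> x * (\<Sum>y\<in>S. pmf \<theta> y * of_bool ((if ?sel x y then x else y) = t)))"
    by (simp only: jump_two[where d = d and s = s, OF assms(2-4)]
        pmf_bind_finite_support[OF assms(1,2)] ret)
  also have "\<dots> = (\<Sum>x\<in>S. \<Sum>y\<in>S. of_bool (x = t) * (pmf \<theta> x * pmf \<theta> y * of_bool (?sel x y))
      + of_bool (y = t) * (pmf \<theta> x * pmf \<theta> y * of_bool (\<not> ?sel x y)))"
    unfolding sum_distrib_left by (intro sum.cong refl) (auto simp: of_bool_def)
  also have "\<dots> = (\<Sum>x\<in>S. of_bool (x = t) * (\<Sum>y\<in>S. pmf \<theta> x * pmf \<theta> y * of_bool (?sel x y)))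
      + (\<Sum>x\<in>S. \<Sum>y\<in>S. of_bool (y = t) * (pmf \<theta> x * pmf \<theta> y * of_bool (\<not> ?sel x y)))"
    by (simp add: sum.distrib sum_distrib_left)
  also have "\<dots> = pmf \<theta> t * (\<Sum>u\<in>S. pmf \<theta> u * (of_bool (?sel t u) + of_bool (\<not> ?sel u t)))"
    unfolding delta by (simp only: sum_distrib_left distrib_left sum.distrib mult_ac)
  also have "(\<Sum>u\<in>S. pmf \<theta> u * (of_bool (?sel t u) + of_bool (\<not> ?sel u t))) =
    (if j = 1 then 2 - closer_mass S d \<theta> s t else closer_mass S d \<theta> s t)"
  proof (cases "j = 1")
    case True
    have "(\<Sum>u\<in>S. pmf \<theta> u * (of_bool (?sel t u) + of_bool (\<not> ?sel u t))) =
      (\<Sum>u\<in>S. 2 * pmf \<theta> u - pmf \<theta> u * (of_bool (d s u < d s t) + of_bool (d s u \<le> d s t)))"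
      using True by (intro sum.cong refl) (auto simp: of_bool_def)
    then show ?thesis
      using True sum_pmf_eq_1[OF assms(1,2)]
      by (simp add: closer_mass_def sum_subtractf flip: sum_distrib_left)
  next
    case False
    then show ?thesis
      unfolding closer_mass_def by (auto intro!: sum.cong simp: not_le)
  qed
  finally show ?thesis .
qed

lemma closer_mass_bounds:
  assumes "finite S" "set_pmf \<theta> \<subseteq> S" "t \<in> S"
  shows "pmf \<theta> t \<le> closer_mass S d \<theta> s t" "closer_mass S d \<theta> s t \<le> 2 - pmf \<theta> t"
proof -
  have "(\<Sum>u\<in>S. pmf \<theta> u * of_bool (u = t)) \<le> closer_mass S d \<theta> s t"
    unfolding closer_mass_def by (intro sum_mono mult_left_mono) auto
  then show "pmf \<theta> t \<le> closer_mass S d \<theta> s t" using assms by (simp add: of_bool_def if_distrib sum.delta cong: if_cong)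
  have "closer_mass S d \<theta> s t \<le> (\<Sum>u\<in>S. pmf \<theta> u * (2 - of_bool (u = t)))"
    unfolding closer_mass_def by (intro sum_mono mult_left_mono) auto
  also have "\<dots> = (\<Sum>u\<in>S. 2 * pmf \<theta> u - (if u = t then pmf \<theta> t else 0))"
    by (intro sum.cong) auto
  also have "\<dots> = 2 - pmf \<theta> t"
    using assms(1,3) sum_pmf_eq_1[OF assms(1,2)]
    by (simp add: sum_subtractf flip: sum_distrib_left)
  finally show "closer_mass S d \<theta> s t \<le> 2 - pmf \<theta> t" .
qed

lemma closer_mass_farthest:
  assumes "finite S" "set_pmf \<theta> \<subseteq> S" "t \<in> S" "inj_on (d s) S"
    and "\<And>u. u \<in> S \<Longrightarrow> d s u \<le> d s t"
  shows "closer_mass S d \<theta> s t = 2 - pmf \<theta> t"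
proof -
  have "closer_mass S d \<theta> s t = (\<Sum>u\<in>S. 2 * pmf \<theta> u - (if u = t then pmf \<theta> t else 0))"
    unfolding closer_mass_def
    using assms(3-5) by (intro sum.cong refl) (force simp: less_le dest: inj_onD)
  then show ?thesis
    using assms(1,3) sum_pmf_eq_1[OF assms(1,2)]
    by (simp add: sum_subtractf flip: sum_distrib_left)
qed

lemma closer_mass_other:
  assumes "finite S" "s \<in> S" "t \<in> S" "d s s < d s t"
  shows "pmf \<theta> t + 2 * pmf \<theta> s \<le> closer_mass S d \<theta> s t"
proof -
  have "(\<Sum>u\<in>{s, t}. pmf \<theta> u * (of_bool (d s u < d s t) + of_bool (d s u \<le> d s t)))
      \<le> closer_mass S d \<theta> s t"
    unfolding closer_mass_def using assms by (intro sum_mono2) auto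
  moreover have "s \<noteq> t" using assms(4) by auto
  ultimately show ?thesis using assms(4) by simp
qed

text \<open>
  The chain can reach \<open>t\<close> from everywhere by drawing \<open>t\<close> twice, so the stationary distribution is unique
  and \<open>\<theta>\<close> itself must be stationary. The stationarity equation at \<open>t\<close> has the factor \<open>pmf \<theta> t\<close> on
  both sides; cancelling it leaves the same condition for both values of \<open>j\<close>.
\<close>

lemma invariant_full_support_balance:
  assumes fin: "finite S" and inj: "\<And>s. s \<in> S \<Longrightarrow> inj_on (d s) S"
    and j: "j \<in> {1, 2}" and inv: "invariant_dist S d j 2 \<theta>"
    and full: "\<And>s. s \<in> S \<Longrightarrow> 0 < pmf \<theta> s" and t: "t \<in> S"
  shows "(\<Sum>s\<in>S. pmf \<theta> s * closer_mass S d \<theta> s t) = 1"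
proof -
  have supp: "set_pmf \<theta> \<subseteq> S" and fix\<theta>: "\<pi>_map S d j 2 \<theta> = \<theta>"
    using inv by (auto simp: invariant_dist_def prob_measures_on_def)
  let ?K = "jump d j 2 \<theta>"
  have minor: "pmf \<theta> t * pmf \<theta> t \<le> pmf (?K s) t" if "s \<in> S" for s
    using closer_mass_bounds[OF fin supp t, of d s]
    by (simp add: pmf_jump_two[where d = d and s = s, OF fin supp inj[OF that] j t] mult_left_mono)
  have suppK: "set_pmf (?K s) \<subseteq> S" if "s \<in> S" for s
    using supp by (auto simp: jump_two[where d = d and s = s, OF supp inj[OF that] j])
  have "\<exists>!\<phi>. stationary S ?K \<phi>"
    using full[OF t]
    by (intro doeblin_unique_stationary[of S ?K t "pmf \<theta> t * pmf \<theta> t"] fin suppK t minor) auto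
  then have "stationary S ?K \<theta>"
    using theI'[of "stationary S ?K"] fix\<theta> by (simp add: \<pi>_map_def)
  then have "pmf \<theta> t = pmf (bind_pmf \<theta> ?K) t"
    by (simp add: stationary_def)
  also have "\<dots> = (\<Sum>s\<in>S. pmf \<theta> s * (pmf \<theta> t *
      (if j = 1 then 2 - closer_mass S d \<theta> s t else closer_mass S d \<theta> s t)))"
    using pmf_jump_two[where d = d, OF fin supp inj j t] by (simp add: pmf_bind_finite_support[OF fin supp])
  also have "\<dots> = pmf \<theta> t * (\<Sum>s\<in>S. pmf \<theta> s *
      (if j = 1 then 2 - closer_mass S d \<theta> s t else closer_mass S d \<theta> s t))"
    by (simp add: sum_distrib_left mult.left_commute)
  finally have "(\<Sum>s\<in>S. pmf \<theta> s *
      (if j = 1 then 2 - closer_mass S d \<theta> s t else closer_mass S d \<theta> s t)) = 1"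
    using full[OF t] by simp
  then show ?thesis
    using sum_pmf_eq_1[OF fin supp]
    by (cases "j = 1") (simp_all add: right_diff_distrib sum_subtractf flip: sum_distrib_right)
qed

text \<open>
  The balance equations for \<open>x\<close> and \<open>y\<close> are added with such weights that a point \<open>s\<close> contributes \<open>1\<close>
  to the equation of its farthest point and at least \<open>-1\<close> to the other one. Hence no \<open>s\<close> contributes
  a negative amount in total, and a third point contributes a positive amount, because it is closer
  to itself than \<open>x\<close> and \<open>y\<close> are.
\<close>

lemma no_invariant_if_two_farthest_points:
  assumes fin: "finite S" and card: "card S \<ge> 3"
    and inj: "\<And>s. s \<in> S \<Longrightarrow> inj_on (d s) S"
    and self: "\<And>s t. s \<in> S \<Longrightarrow> t \<in> S \<Longrightarrow> s \<noteq> t \<Longrightarrow> d s s < d s t"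
    and xy: "x \<in> S" "y \<in> S"
    and far: "\<And>s u. s \<in> S \<Longrightarrow> u \<in> S \<Longrightarrow> d s u \<le> max (d s x) (d s y)"
    and j: "j \<in> {1, 2}" and full: "\<And>s. s \<in> S \<Longrightarrow> 0 < pmf \<theta> s"
  shows "\<not> invariant_dist S d j 2 \<theta>"
proof
  assume inv: "invariant_dist S d j 2 \<theta>"
  then have supp: "set_pmf \<theta> \<subseteq> S"
    by (auto simp: invariant_dist_def prob_measures_on_def)
  \<comment> \<open>The normalisation that gives the value 1 when \<open>t\<close> is farthest from \<open>s\<close>, and at least -1 always.\<close>
  define g where "g s t = (closer_mass S d \<theta> s t - 1) / (1 - pmf \<theta> t)" for s t
  have lt1: "pmf \<theta> t < 1" if "t \<in> S" for t
  proof -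
    have "card (S - {t}) \<noteq> 0" using card that fin by simp
    then have "S - {t} \<noteq> {}" by (metis card.empty)
    then obtain u where u: "u \<in> S" "u \<noteq> t" by blast
    have "(\<Sum>s\<in>{t, u}. pmf \<theta> s) \<le> (\<Sum>s\<in>S. pmf \<theta> s)"
      using fin that u by (intro sum_mono2) auto
    then show ?thesis using u full[OF u(1)] sum_pmf_eq_1[OF fin supp] by simp
  qed
  have balance: "(\<Sum>s\<in>S. pmf \<theta> s * g s t) = 0" if t: "t \<in> S" for t
  proof -
    have "(\<Sum>s\<in>S. pmf \<theta> s * g s t) =
        (\<Sum>s\<in>S. pmf \<theta> s * closer_mass S d \<theta> s t - pmf \<theta> s) / (1 - pmf \<theta> t)"
      unfolding g_def sum_divide_distrib by (intro sum.cong) (auto simp: right_diff_distrib)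
    then show ?thesis
      using invariant_full_support_balance[where d = d, OF fin inj j inv full t]
        sum_pmf_eq_1[OF fin supp]
      by (simp add: sum_subtractf)
  qed
  have g_ge: "-1 \<le> g s t" if "t \<in> S" for s t
    using closer_mass_bounds(1)[OF fin supp that, of d s] lt1[OF that] by (simp add: g_def field_simps)
  have g_gt: "-1 < g s t" if "s \<in> S" "t \<in> S" "s \<noteq> t" for s t
    using closer_mass_other[where d = d and s = s and t = t, OF fin that(1,2) self[OF that], of \<theta>] lt1[OF that(2)] full[OF that(1)]
    by (simp add: g_def field_simps)
  have g_far: "g s x = 1 \<or> g s y = 1" if s: "s \<in> S" for s
  proof (cases "d s x \<le> d s y")
    case True
    then have "d s u \<le> d s y" if "u \<in> S" for u using far[OF s that] by simp
    then have "closer_mass S d \<theta> s y = 2 - pmf \<theta> y"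
      by (rule closer_mass_farthest[where d = d and s = s, OF fin supp xy(2) inj[OF s]])
    then show ?thesis using lt1[OF xy(2)] by (simp add: g_def)
  next
    case False
    then have "d s u \<le> d s x" if "u \<in> S" for u using far[OF s that] by simp
    then have "closer_mass S d \<theta> s x = 2 - pmf \<theta> x"
      by (rule closer_mass_farthest[where d = d and s = s, OF fin supp xy(1) inj[OF s]])
    then show ?thesis using lt1[OF xy(1)] by (simp add: g_def)
  qed
  have "card {x, y} \<le> 2" by (simp add: card_insert_if)
  then have "\<not> S \<subseteq> {x, y}"
    using card card_mono[of "{x, y}" S] by auto
  then obtain z where z: "z \<in> S" "z \<noteq> x" "z \<noteq> y" by auto
  have "0 < (\<Sum>s\<in>S. pmf \<theta> s * (g s x + g s y))"
  proof (rule sum_pos2[OF fin z(1)])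
    show "0 < pmf \<theta> z * (g z x + g z y)"
      using full z g_far[OF z(1)] g_gt[OF z(1) xy(1)] g_gt[OF z(1) xy(2)]
      by (intro mult_pos_pos) auto
    show "0 \<le> pmf \<theta> s * (g s x + g s y)" if "s \<in> S" for s
      using g_far[OF that] g_ge[OF xy(1), of s] g_ge[OF xy(2), of s]
      by (intro mult_nonneg_nonneg) auto
  qed
  also have "\<dots> = 0"
    using balance xy by (simp add: distrib_left sum.distrib)
  finally show False by simp
qed

section \<open>Leaves of binary trees\<close>

theorem theorem7:
  fixes T :: "'v pair_pre_digraph" and len :: "'v \<times> 'v \<Rightarrow> real"
    and S :: "'v set" and d :: "'v \<Rightarrow> 'v \<Rightarrow> real" and j :: nat
  assumes "btl_space T len S d"
    and "card S \<ge> 3"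
    and "\<forall>s\<in>S. inj_on (d s) (S - {s})"
    and "j \<in> {1, 2}"
  shows "\<not> (\<exists>\<theta>. invariant_dist S d j 2 \<theta> \<and> (\<forall>s\<in>S. 0 < pmf \<theta> s))"
proof -
  interpret binary_tree T len using assms(1) by (simp add: btl_space_def)
  have d: "d s t = tree_dist s t" if "s \<in> S" "t \<in> S" for s t
    using assms(1) that by (simp add: btl_space_def)
  have SV: "S \<subseteq> pverts T"
    using assms(1) by (auto simp: btl_space_def leaves_def)
  then have fin: "finite S"
    using pair_finite_verts finite_subset by blast
  have self: "d s s < d s t" if "s \<in> S" "t \<in> S" "s \<noteq> t" for s t
    using that tree_dist_pos[of s t] tree_dist_self[of s] subsetD[OF SV] by (simp add: d)
  have inj: "inj_on (d s) S" if s: "s \<in> S" for s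
  proof (rule inj_onI)
    fix u v assume uv: "u \<in> S" "v \<in> S" "d s u = d s v"
    then have "u = s \<longleftrightarrow> v = s"
      using self[OF s, of u] self[OF s, of v] by force
    then show "u = v"
      using uv assms(3) s by (auto dest: inj_onD)
  qed
  let ?D = "(\<lambda>(u, v). d u v) ` (S \<times> S)"
  have D: "finite ?D" "?D \<noteq> {}" using fin assms(2) by auto
  then have "Max ?D \<in> ?D" by (rule Max_in)
  then obtain x y where xy: "x \<in> S" "y \<in> S" "Max ?D = d x y" by auto
  have diam: "d u v \<le> d x y" if "u \<in> S" "v \<in> S" for u v
    using Max_ge[OF D(1), of "d u v"] that xy(3) by force
  have "d s u \<le> max (d s x) (d s y)" if "s \<in> S" "u \<in> S" for s u
    using diameter_end_farthest[OF SV xy(1,2), of s u] diam that SV xy(1,2) by (auto simp: d)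
  then show ?thesis
    using no_invariant_if_two_farthest_points[where d = d, OF fin assms(2) inj self xy(1,2) _ assms(4)]
    by blast
qed

end
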